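(* Let $r\geq 2$ and let $(P,\mathcal{L})$ be an $r$-uniform linear system with $|\mathcal{L}|>\nu_2(P,\mathcal{L})$. If $\nu_2(P,\mathcal{L})=4$, then $$\tau(P,\mathcal{L})\leq \frac{|P|+|\mathcal{L}|}{r+1}.$$
   Context: A linear system is a pair $(P,\mathcal{L})$ where $P$ is a finite set (points) and $\mathcal{L}$ is a family of subsets of $P$ (lines) such that $|l\cap l'|\leq 1$ for all distinct $l,l'\in\mathcal{L}$. It is $r$-uniform if every line has exactly $r$ points. A transversal is a set $T\subseteq P$ meeting every line; $\tau(P,\mathcal{L})$ is the minimum size of a transversal. A 2-packing is a set $R\subseteq\mathcal{L}$ of lines such that no three lines of $R$ have a common point; $\nu_2(P,\mathcal{L})$ is the maximum size of a 2-packing. *)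

theory Defs
  imports Complex_Main
begin

definition linear_system :: "'a set \<Rightarrow> 'a set set \<Rightarrow> bool" where
  "linear_system P L \<longleftrightarrow>
     finite P \<and> (\<forall>l\<in>L. l \<subseteq> P) \<and> (\<forall>l\<in>L. \<forall>l'\<in>L. l \<noteq> l' \<longrightarrow> card (l \<inter> l') \<le> 1)"

definition uniform_system :: "nat \<Rightarrow> 'a set set \<Rightarrow> bool" where
  "uniform_system r L \<longleftrightarrow> (\<forall>l\<in>L. card l = r)"

definition transversal :: "'a set \<Rightarrow> 'a set set \<Rightarrow> 'a set \<Rightarrow> bool" where
  "transversal P L T \<longleftrightarrow> T \<subseteq> P \<and> (\<forall>l\<in>L. T \<inter> l \<noteq> {})"

text \<open>For finite \<open>P\<close> the set under \<open>Min\<close> is finite; it is nonempty as soon as no line is empty,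
  since then \<open>P\<close> itself is a transversal.\<close>

definition transversal_number :: "'a set \<Rightarrow> 'a set set \<Rightarrow> nat" where
  "transversal_number P L = Min {card T |T. transversal P L T}"

definition two_packing :: "'a set \<Rightarrow> 'a set set \<Rightarrow> 'a set set \<Rightarrow> bool" where
  "two_packing P L R \<longleftrightarrow> R \<subseteq> L \<and>
     (\<forall>a\<in>R. \<forall>b\<in>R. \<forall>c\<in>R. a \<noteq> b \<and> a \<noteq> c \<and> b \<noteq> c \<longrightarrow> \<not> (\<exists>p\<in>P. p \<in> a \<and> p \<in> b \<and> p \<in> c))"

definition two_packing_number :: "'a set \<Rightarrow> 'a set set \<Rightarrow> nat" where
  "two_packing_number P L = Max {card R |R. two_packing P L R}"

end

theory Submission
  imports Defs
begin

text \<open>Fix a maximum 2-packing \<open>R\<close> of four lines, let \<open>D\<close> be the set of points lying on two of them,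
  and let \<open>o\<close> be the number of points off \<open>R\<close>. By maximality every other line meets \<open>D\<close>, in one
  point (a tangent) or in two (a secant); the two points of a secant lie on complementary pairs of
  lines of \<open>R\<close>. With \<open>H\<close> the set of points at which there is a tangent and \<open>s\<close> the number of
  secants, counting gives \<open>|P| = 4 r + o - |D|\<close> and \<open>|L| \<ge> 4 + |H| + s\<close>.

  Tangents at two points of \<open>H\<close> off a line \<open>a \<in> R\<close> meet on \<open>a\<close>: otherwise they could replace one
  line of \<open>R\<close>, giving a 2-packing of size five. So once there are two such points, all tangents at
  points off \<open>a\<close> pass through a single point of \<open>a\<close>, which lies outside \<open>D\<close>; this also forces
  \<open>|D| \<le> r + 2\<close>. These pencils provide four points meeting all lines, and even three unless
  \<open>|D| \<le> |H| + s + o\<close>, in which case \<open>|P| + |L| \<ge> 4 r + 4\<close>. The same count gives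
  \<open>|P| + |L| \<ge> 3 r + 3\<close> unless the four lines meet pairwise and all other lines are tangents at a
  single point; then two points suffice.\<close>

subsection \<open>Linear systems and 2-packings\<close>

lemma linear_system_finite: "linear_system P L \<Longrightarrow> finite L"
  by (auto simp: linear_system_def intro: finite_subset[of L "Pow P"])

lemma linear_system_finite_line: "linear_system P L \<Longrightarrow> l \<in> L \<Longrightarrow> finite l"
  by (auto simp: linear_system_def intro: finite_subset)

lemma linear_system_unique_point:
  assumes "linear_system P L" "l \<in> L" "l' \<in> L" "l \<noteq> l'" "p \<in> l" "p \<in> l'" "q \<in> l" "q \<in> l'"
  shows "p = q"
proof -
  have "finite (l \<inter> l')" "card (l \<inter> l') \<le> Suc 0"
    using assms linear_system_finite_line[OF assms(1,2)] by (auto simp: linear_system_def)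
  then show ?thesis using assms(5-) card_le_Suc0_iff_eq by blast
qed

lemma transversal_number_le_card:
  assumes "finite P" "transversal P L T"
  shows "transversal_number P L \<le> card T"
proof -
  have "{card T |T. transversal P L T} \<subseteq> card ` Pow P" by (auto simp: transversal_def)
  then have "finite {card T |T. transversal P L T}"
    using assms(1) by (meson finite_Pow_iff finite_imageI finite_subset)
  then show ?thesis unfolding transversal_number_def using assms(2) by (intro Min_le) auto
qed

lemma finite_two_packing_cards:
  assumes "finite L"
  shows "finite {card R |R. two_packing P L R}"
proof -
  have "{card R |R. two_packing P L R} \<subseteq> card ` Pow L" by (auto simp: two_packing_def)
  then show ?thesis using assms by (meson finite_Pow_iff finite_imageI finite_subset)
qed

lemma card_le_two_packing_number:
  assumes "finite L" "two_packing P L R"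
  shows "card R \<le> two_packing_number P L"
  unfolding two_packing_number_def
  using finite_two_packing_cards[OF assms(1)] assms(2) by (intro Max_ge) auto

lemma two_packing_number_attained:
  assumes "finite L"
  obtains R where "two_packing P L R" "card R = two_packing_number P L"
proof -
  have "two_packing P L {}" by (simp add: two_packing_def)
  then have "two_packing_number P L \<in> {card R |R. two_packing P L R}"
    unfolding two_packing_number_def using finite_two_packing_cards[OF assms] by (intro Max_in) auto
  then show thesis using that by auto
qed

lemma two_packing_iff_card_le_2:
  assumes "linear_system P L" "R \<subseteq> L"
  shows "two_packing P L R \<longleftrightarrow> (\<forall>p. card {x \<in> R. p \<in> x} \<le> 2)"
proof
  assume packing: "two_packing P L R"
  show "\<forall>p. card {x \<in> R. p \<in> x} \<le> 2"
  proof (rule allI, rule ccontr)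
    fix p
    assume "\<not> card {x \<in> R. p \<in> x} \<le> 2"
    then have "3 \<le> card {x \<in> R. p \<in> x}" by simp
    then obtain S where "S \<subseteq> {x \<in> R. p \<in> x}" "card S = 3"
      by (rule obtain_subset_with_card_n)
    then obtain x y z where xyz: "x \<in> R" "y \<in> R" "z \<in> R" "p \<in> x" "p \<in> y" "p \<in> z"
      "x \<noteq> y" "x \<noteq> z" "y \<noteq> z"
      by (auto simp: card_3_iff)
    then have "p \<in> P" using assms by (auto simp: linear_system_def)
    with xyz show False using packing unfolding two_packing_def by meson
  qed
next
  assume le: "\<forall>p. card {x \<in> R. p \<in> x} \<le> 2"
  have False if "x \<in> R" "y \<in> R" "z \<in> R" "x \<noteq> y" "x \<noteq> z" "y \<noteq> z" "p \<in> x" "p \<in> y" "p \<in> z" for x y z p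
  proof -
    have "card {x, y, z} \<le> card {x \<in> R. p \<in> x}"
      using that finite_subset[OF assms(2) linear_system_finite[OF assms(1)]]
      by (intro card_mono) auto
    then show False using that le[rule_format, of p] by simp
  qed
  then show "two_packing P L R" using assms(2) unfolding two_packing_def by blast
qed

subsection \<open>Crossings, tangents and secants of a 2-packing\<close>

locale uniform_two_packing =
  fixes P :: "'a set" and L R :: "'a set set" and r :: nat
  assumes linear: "linear_system P L"
    and uniform: "uniform_system r L"
    and r_pos: "0 < r"
    and packing: "two_packing P L R"
begin

definition lines_through :: "'a \<Rightarrow> 'a set set" where
  "lines_through p = {x \<in> R. p \<in> x}"

definition crossings :: "'a set" where
  "crossings = {p. card (lines_through p) = 2}"

definition tangents :: "'a set set" where
  "tangents = {l \<in> L - R. card (l \<inter> crossings) = 1}"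

definition secants :: "'a set set" where
  "secants = {l \<in> L - R. card (l \<inter> crossings) = 2}"

definition tangency_points :: "'a set" where
  "tangency_points = crossings \<inter> \<Union> tangents"

definition opposite :: "'a \<Rightarrow> 'a \<Rightarrow> bool" where
  "opposite p q \<longleftrightarrow> lines_through p = R - lines_through q"

lemma finite_P: "finite P"
  using linear by (simp add: linear_system_def)

lemma finite_L: "finite L"
  using linear by (rule linear_system_finite)

lemma R_subset_L: "R \<subseteq> L"
  using packing by (simp add: two_packing_def)

lemma finite_R: "finite R"
  using R_subset_L finite_L by (rule finite_subset)

lemma line_subset_P: "l \<in> L \<Longrightarrow> l \<subseteq> P"
  using linear by (simp add: linear_system_def)

lemma finite_line: "l \<in> L \<Longrightarrow> finite l"
  using linear by (rule linear_system_finite_line)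

lemma card_line: "l \<in> L \<Longrightarrow> card l = r"
  using uniform by (simp add: uniform_system_def)

lemma line_nonempty: "l \<in> L \<Longrightarrow> l \<noteq> {}"
  using card_line r_pos by fastforce

lemmas unique_point = linear_system_unique_point[OF linear]

lemma Union_R_subset_P: "\<Union> R \<subseteq> P"
  using R_subset_L line_subset_P by blast

lemma lines_through_subset: "lines_through p \<subseteq> R"
  by (auto simp: lines_through_def)

lemma finite_lines_through: "finite (lines_through p)"
  using lines_through_subset finite_R by (rule finite_subset)

lemma mem_lines_through [simp]: "x \<in> lines_through p \<longleftrightarrow> x \<in> R \<and> p \<in> x"
  by (simp add: lines_through_def)

lemma card_lines_through_le_2: "card (lines_through p) \<le> 2"
  using packing two_packing_iff_card_le_2[OF linear R_subset_L] by (simp add: lines_through_def)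

lemma opposite_cover: "opposite p q \<Longrightarrow> x \<in> R \<Longrightarrow> p \<in> x \<or> q \<in> x"
  using mem_lines_through[of x p] by (auto simp: opposite_def)

lemma crossingI:
  assumes "x \<in> R" "y \<in> R" "x \<noteq> y" "p \<in> x" "p \<in> y"
  shows "p \<in> crossings"
proof -
  have "card {x, y} \<le> card (lines_through p)"
    using assms by (intro card_mono finite_lines_through) auto
  then show ?thesis using card_lines_through_le_2[of p] assms(3) by (simp add: crossings_def)
qed

lemma lines_through_eq:
  assumes "x \<in> R" "y \<in> R" "x \<noteq> y" "p \<in> x" "p \<in> y"
  shows "lines_through p = {x, y}"
  using crossingI[OF assms] assms
  by (intro card_subset_eq[symmetric] finite_lines_through) (auto simp: crossings_def)

lemma crossingE:
  assumes "p \<in> crossings"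
  obtains x y where "x \<in> R" "y \<in> R" "x \<noteq> y" "p \<in> x" "p \<in> y" "lines_through p = {x, y}"
proof -
  obtain x y where "lines_through p = {x, y}" "x \<noteq> y"
    using assms by (auto simp: crossings_def card_2_iff)
  moreover from this have "x \<in> R" "y \<in> R" "p \<in> x" "p \<in> y"
    using mem_lines_through[of _ p] by auto
  ultimately show thesis using that by blast
qed

lemma crossing_other_line:
  assumes "p \<in> crossings" "x \<in> R" "p \<in> x"
  obtains y where "y \<in> R" "y \<noteq> x" "p \<in> y" "lines_through p = {x, y}"
proof -
  obtain y z where "y \<in> R" "z \<in> R" "y \<noteq> z" "p \<in> y" "p \<in> z" "lines_through p = {y, z}"
    using assms(1) by (rule crossingE)
  moreover from this have "x = y \<or> x = z" using assms(2,3) mem_lines_through[of x p] by simp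
  ultimately show thesis using that[of y] that[of z] by (auto simp: insert_commute)
qed

lemma crossings_subset: "crossings \<subseteq> \<Union> R"
  by (blast elim: crossingE)

lemma crossings_subset_P: "crossings \<subseteq> P"
  using crossings_subset Union_R_subset_P by blast

lemma finite_crossings: "finite crossings"
  using crossings_subset_P finite_P by (rule finite_subset)

lemma tangency_points_subset: "tangency_points \<subseteq> crossings"
  by (simp add: tangency_points_def)

lemma finite_tangency_points: "finite tangency_points"
  using tangency_points_subset finite_crossings by (rule finite_subset)

lemma inj_on_lines_through: "inj_on lines_through crossings"
proof (rule inj_onI)
  fix p q
  assume p: "p \<in> crossings" and eq: "lines_through p = lines_through q"
  obtain x y where xy: "x \<in> R" "y \<in> R" "x \<noteq> y" "p \<in> x" "p \<in> y" "lines_through p = {x, y}"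
    using p by (rule crossingE)
  then have "q \<in> x" "q \<in> y" using eq mem_lines_through[of _ q] by auto
  then show "p = q" using unique_point[of x y p q] xy R_subset_L by auto
qed

lemma card_crossings_within_le:
  assumes "X \<subseteq> R"
  shows "card {p \<in> crossings. lines_through p \<subseteq> X} \<le> card X choose 2"
proof -
  have fin: "finite X" using assms finite_R by (rule finite_subset)
  have "card {p \<in> crossings. lines_through p \<subseteq> X}
      \<le> card {e. e \<subseteq> X \<and> card e = 2}"
    using fin by (intro card_inj_on_le[of lines_through] inj_on_subset[OF inj_on_lines_through])
      (auto simp: crossings_def)
  then show ?thesis by (simp add: n_subsets[OF fin])
qed

lemma card_crossings_le_choose: "card crossings \<le> card R choose 2"
  using card_crossings_within_le[of R] lines_through_subset by simp

lemma card_crossings_off_line_le: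
  assumes "a \<in> R"
  shows "card (crossings - a) \<le> (card R - 1) choose 2"
proof -
  have "crossings - a = {p \<in> crossings. lines_through p \<subseteq> R - {a}}" using assms by auto
  then show ?thesis
    using card_crossings_within_le[of "R - {a}"] assms finite_R by simp
qed

lemma sum_card_crossings_on_lines:
  assumes "X \<subseteq> crossings"
  shows "(\<Sum>x\<in>R. card (X \<inter> x)) = 2 * card X"
proof -
  have "(\<Sum>x\<in>R. card {p \<in> X. p \<in> x}) = 2 * card X"
    using assms finite_subset[OF assms finite_crossings] finite_R
    by (intro sum_multicount) (auto simp: crossings_def lines_through_def)
  then show ?thesis by (simp add: Int_def)
qed

lemma card_crossings_le: "2 * card crossings \<le> card R * r"
proof -
  have "2 * card crossings = (\<Sum>x\<in>R. card (crossings \<inter> x))"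
    using sum_card_crossings_on_lines[of crossings] by simp
  also have "\<dots> \<le> (\<Sum>x\<in>R. r)"
    using R_subset_L finite_line card_line by (intro sum_mono) (metis Int_lower2 card_mono subsetD)
  finally show ?thesis by simp
qed

lemma card_Union_packing_eq: "card R * r = card (\<Union> R) + card crossings"
proof -
  have finite_Union: "finite (\<Union> R)" using Union_R_subset_P finite_P by (rule finite_subset)
  have degree: "card {x \<in> R. p \<in> x} = 1 + of_bool (p \<in> crossings)" if "p \<in> \<Union> R" for p
  proof -
    have "lines_through p \<noteq> {}" using that by (auto simp: lines_through_def)
    then have "1 \<le> card (lines_through p)"
      using finite_lines_through by (simp add: Suc_le_eq card_gt_0_iff)
    then show ?thesis
      using card_lines_through_le_2[of p] by (auto simp: crossings_def lines_through_def)
  qed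
  have "card R * r = (\<Sum>x\<in>R. card {p \<in> \<Union> R. p \<in> x})"
  proof -
    have "card {p \<in> \<Union> R. p \<in> x} = r" if "x \<in> R" for x
    proof -
      have "{p \<in> \<Union> R. p \<in> x} = x" using that by auto
      then show ?thesis using card_line that R_subset_L by auto
    qed
    then show ?thesis by simp
  qed
  also have "\<dots> = (\<Sum>p\<in>\<Union> R. 1 + of_bool (p \<in> crossings))"
    using degree finite_R finite_Union by (intro sum_multicount_gen) auto
  also have "\<dots> = card (\<Union> R) + card (\<Union> R \<inter> crossings)"
    using finite_Union by (simp only: sum.distrib sum_of_bool_eq) simp
  finally show ?thesis using crossings_subset by (simp add: Int_absorb1)
qed

lemma card_points_eq: "card R * r + card (P - \<Union> R) = card P + card crossings"
proof -
  have "card P = card (P \<inter> \<Union> R) + card (P - \<Union> R)" using finite_P by (rule card_Int_Diff)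
  then show ?thesis using card_Union_packing_eq Union_R_subset_P by (simp add: Int_absorb1)
qed

lemma tangent_crossings:
  assumes "l \<in> tangents" "p \<in> l" "p \<in> crossings"
  shows "l \<inter> crossings = {p}"
proof -
  obtain q where "l \<inter> crossings = {q}"
    using assms(1) by (auto simp: tangents_def card_1_singleton_iff)
  moreover from this have "p \<in> {q}" using assms(2,3) by blast
  ultimately show ?thesis by simp
qed

lemma tangencyE:
  assumes "p \<in> tangency_points"
  obtains l where "l \<in> tangents" "l \<inter> crossings = {p}"
  using assms tangent_crossings by (auto simp: tangency_points_def)

lemma tangent_tangency_point:
  assumes "l \<in> tangents"
  obtains p where "p \<in> tangency_points" "l \<inter> crossings = {p}"
proof -
  obtain p where "l \<inter> crossings = {p}"
    using assms by (auto simp: tangents_def card_1_singleton_iff)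
  then show thesis using that assms by (auto simp: tangency_points_def)
qed

lemma finite_tangents: "finite tangents"
  using finite_L by (simp add: tangents_def)

lemma finite_secants: "finite secants"
  using finite_L by (simp add: secants_def)

lemma secant_line: "l \<in> secants \<Longrightarrow> l \<in> L"
  by (simp add: secants_def)

lemma card_lines_ge: "card R + card tangency_points + card secants \<le> card L"
proof -
  have "card tangency_points = card (\<Union>l\<in>tangents. l \<inter> crossings)"
    by (rule arg_cong[of _ _ card]) (auto simp: tangency_points_def)
  also have "\<dots> \<le> (\<Sum>l\<in>tangents. card (l \<inter> crossings))"
    using finite_tangents by (rule card_UN_le)
  also have "\<dots> = card tangents" by (simp add: tangents_def)
  finally have "card R + card tangency_points + card secants
      \<le> card R + card tangents + card secants" by simp
  also have "\<dots> = card (R \<union> tangents \<union> secants)"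
  proof -
    have "R \<inter> tangents = {}" "(R \<union> tangents) \<inter> secants = {}"
      by (auto simp: tangents_def secants_def)
    then show ?thesis
      using finite_tangents finite_secants finite_R by (simp add: card_Un_disjoint)
  qed
  also have "\<dots> \<le> card L"
    using R_subset_L by (intro card_mono finite_L) (auto simp: tangents_def secants_def)
  finally show ?thesis .
qed

lemma card_lines_through_crossings_of_line:
  assumes "l \<in> L - R"
  shows "card (\<Union>p\<in>l \<inter> crossings. lines_through p) = 2 * card (l \<inter> crossings)"
proof -
  have "lines_through p \<inter> lines_through q = {}" if "p \<in> l" "q \<in> l" "p \<noteq> q" for p q
    using unique_point[of l _ p q] that assms R_subset_L by fastforce
  then have "card (\<Union>p\<in>l \<inter> crossings. lines_through p)
      = (\<Sum>p\<in>l \<inter> crossings. card (lines_through p))"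
    using finite_crossings finite_lines_through by (intro card_UN_disjoint) auto
  then show ?thesis by (simp add: crossings_def)
qed

lemma card_crossings_of_line_le:
  assumes "l \<in> L - R"
  shows "2 * card (l \<inter> crossings) \<le> card R"
  unfolding card_lines_through_crossings_of_line[OF assms, symmetric]
  using finite_R lines_through_subset by (intro card_mono) auto

lemma small_set_meeting_other_lines:
  assumes "a \<in> R"
  obtains T where "T \<subseteq> P" "card T < card R" "a \<inter> crossings \<subseteq> T" "\<forall>x\<in>R - {a}. T \<inter> x \<noteq> {}"
proof -
  have "\<forall>x\<in>R - {a}. \<exists>p. p \<in> x \<and> (x \<inter> a \<noteq> {} \<longrightarrow> p \<in> a)"
    using line_nonempty R_subset_L by blast
  then obtain g where g: "\<And>x. x \<in> R - {a} \<Longrightarrow> g x \<in> x \<and> (x \<inter> a \<noteq> {} \<longrightarrow> g x \<in> a)"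
    by metis
  show thesis
  proof
    show "g ` (R - {a}) \<subseteq> P" using g Union_R_subset_P by blast
    have "card (g ` (R - {a})) \<le> card (R - {a})" using finite_R by (intro card_image_le) simp
    also have "\<dots> < card R" using assms finite_R by (intro psubset_card_mono) auto
    finally show "card (g ` (R - {a})) < card R" .
    show "a \<inter> crossings \<subseteq> g ` (R - {a})"
    proof
      fix p assume p: "p \<in> a \<inter> crossings"
      then obtain y where y: "y \<in> R" "y \<noteq> a" "p \<in> y"
        using assms by (blast elim: crossing_other_line)
      then have "g y = p" using unique_point[of a y "g y" p] g[of y] p assms R_subset_L by blast
      then show "p \<in> g ` (R - {a})" using y by blast
    qed
    show "\<forall>x\<in>R - {a}. g ` (R - {a}) \<inter> x \<noteq> {}" using g by blast
  qed
qed

end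

subsection \<open>Maximum 2-packings\<close>

locale maximum_two_packing = uniform_two_packing +
  assumes maximum: "card R = two_packing_number P L"
begin

lemma larger_set_has_concurrent_lines:
  assumes "X \<subseteq> L" "card R < card X"
  obtains p where "3 \<le> card {x \<in> X. p \<in> x}"
proof -
  have "\<not> two_packing P L X"
    using card_le_two_packing_number[OF finite_L] assms(2) maximum by fastforce
  then obtain p where "\<not> card {x \<in> X. p \<in> x} \<le> 2"
    using two_packing_iff_card_le_2[OF linear assms(1)] by blast
  then show thesis using that[of p] by simp
qed

lemma line_meets_crossings:
  assumes "l \<in> L - R"
  shows "l \<inter> crossings \<noteq> {}"
proof -
  obtain p where p: "3 \<le> card {x \<in> insert l R. p \<in> x}"
    using larger_set_has_concurrent_lines[of "insert l R"] assms R_subset_L finite_R by auto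
  have eq: "{x \<in> insert l R. p \<in> x} =
      (if p \<in> l then insert l (lines_through p) else lines_through p)"
    by auto
  then have "p \<in> l" using p card_lines_through_le_2[of p] by (auto split: if_splits)
  then have "2 \<le> card (lines_through p)"
    using p eq assms finite_lines_through by (simp add: card_insert_if split: if_splits)
  then have "p \<in> crossings" using card_lines_through_le_2[of p] by (simp add: crossings_def)
  then show ?thesis using \<open>p \<in> l\<close> by blast
qed

lemma card_other_lines_through_le_1:
  assumes "a \<in> R" "z \<in> crossings \<Longrightarrow> z \<in> a"
  shows "card (lines_through z - {a}) \<le> 1"
proof (cases "z \<in> crossings")
  case True
  then have "a \<in> lines_through z" using assms by simp
  then show ?thesis using True finite_lines_through by (simp add: crossings_def)
next
  case False
  then show ?thesis
    using card_lines_through_le_2[of z] card_Diff1_le[of "lines_through z" a]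
    unfolding crossings_def by simp
qed

lemma tangents_meet:
  assumes e: "e \<in> tangents" "e \<inter> crossings = {p}" and f: "f \<in> tangents" "f \<inter> crossings = {q}"
    and "p \<noteq> q" and a: "a \<in> R" "p \<in> a" "q \<in> a"
  obtains x z where "x \<in> R" "p \<notin> x" "q \<notin> x" "z \<in> x" "z \<in> e" "z \<in> f"
proof -
  let ?X = "insert e (insert f (R - {a}))"
  have ef: "e \<in> L" "e \<notin> R" "f \<in> L" "f \<notin> R" "e \<noteq> f"
    using e f \<open>p \<noteq> q\<close> by (auto simp: tangents_def)
  have "0 < card R" using a(1) finite_R by (auto simp: card_gt_0_iff)
  then have "card R < card ?X" using ef a(1) finite_R by simp
  moreover have "?X \<subseteq> L" using ef R_subset_L by auto
  ultimately obtain z where z: "3 \<le> card {x \<in> ?X. z \<in> x}"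
    using larger_set_has_concurrent_lines by meson
  have "{x \<in> ?X. z \<in> x} =
      (if z \<in> e then {e} else {}) \<union> (if z \<in> f then {f} else {}) \<union> (lines_through z - {a})"
    by auto
  then have "3 \<le> of_bool (z \<in> e) + of_bool (z \<in> f) + card (lines_through z - {a})"
    using z finite_lines_through ef by (auto simp: card_insert_if split: if_splits)
  moreover have "card (lines_through z - {a}) \<le> 2"
    using card_lines_through_le_2[of z] card_Diff1_le[of "lines_through z" a] by linarith
  moreover have "card (lines_through z - {a}) \<le> 1" if "z \<in> e \<union> f"
    using that e f a by (intro card_other_lines_through_le_1) auto
  ultimately have zef: "z \<in> e" "z \<in> f" and "0 < card (lines_through z - {a})"
    by (cases "z \<in> e"; cases "z \<in> f"; force)+
  then have "lines_through z \<noteq> {}" by force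
  then obtain x where x: "x \<in> R" "z \<in> x" by (auto simp: lines_through_def)
  have pq: "p \<in> e" "p \<notin> f" "q \<in> f" "q \<notin> e" using e(2) f(2) \<open>p \<noteq> q\<close> by auto
  have "p \<notin> x" using unique_point[of x e p z] x zef ef pq R_subset_L by blast
  moreover have "q \<notin> x" using unique_point[of x f q z] x zef ef pq R_subset_L by blast
  ultimately show thesis using that x zef by blast
qed

end

subsection \<open>Maximum 2-packings of four lines\<close>

locale maximum_four_packing = maximum_two_packing +
  assumes card_R: "card R = 4"
    and more_lines: "4 < card L"
begin

lemma line_cases:
  assumes "l \<in> L"
  obtains (packing) "l \<in> R" | (tangent) "l \<in> tangents" | (secant) "l \<in> secants"
proof (cases "l \<in> R")
  case False
  then have "l \<in> L - R" using assms by simp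
  moreover from this have "0 < card (l \<inter> crossings)" "card (l \<inter> crossings) \<le> 2"
    using line_meets_crossings card_crossings_of_line_le[of l] card_R finite_crossings
    by (auto simp: card_gt_0_iff)
  then have "card (l \<inter> crossings) = 1 \<or> card (l \<inter> crossings) = 2" by linarith
  ultimately show thesis using that(2,3) by (auto simp: tangents_def secants_def)
qed (rule that(1))

lemma transversal_number_leI:
  assumes "T \<subseteq> P" "card T \<le> k"
    and "\<And>x. x \<in> R \<Longrightarrow> T \<inter> x \<noteq> {}"
    and "\<And>l p. l \<in> tangents \<Longrightarrow> p \<in> tangency_points \<Longrightarrow> l \<inter> crossings = {p} \<Longrightarrow> T \<inter> l \<noteq> {}"
    and "\<And>l. l \<in> secants \<Longrightarrow> T \<inter> l \<noteq> {}"
  shows "transversal_number P L \<le> k"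
proof -
  have "T \<inter> l \<noteq> {}" if "l \<in> L" for l
    using that
  proof (cases rule: line_cases)
    case tangent
    then show ?thesis using assms(4) by (metis tangent_tangency_point)
  qed (use assms(3,5) in auto)
  then have "transversal P L T" using assms(1) by (simp add: transversal_def)
  then show ?thesis using transversal_number_le_card[OF finite_P] assms(2) le_trans by blast
qed

lemma secant_crossing_on_line:
  assumes "l \<in> secants" "x \<in> R"
  shows "l \<inter> x \<inter> crossings \<noteq> {}"
proof -
  have "card (\<Union>p\<in>l \<inter> crossings. lines_through p) = card R"
    using card_lines_through_crossings_of_line[of l] assms(1) card_R by (simp add: secants_def)
  then have "(\<Union>p\<in>l \<inter> crossings. lines_through p) = R"
    using finite_R lines_through_subset by (intro card_subset_eq) auto
  then have "x \<in> (\<Union>p\<in>l \<inter> crossings. lines_through p)" using assms(2) by simp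
  then show ?thesis by auto
qed

lemma card_secant_off_packing:
  assumes "l \<in> secants"
  shows "card (l - \<Union> R) + 2 = r"
proof -
  have l: "l \<in> L" "l \<notin> R" using assms by (auto simp: secants_def)
  have "p \<in> crossings" if p: "p \<in> l" "p \<in> x" "x \<in> R" for p x
  proof -
    obtain q where "q \<in> l" "q \<in> x" "q \<in> crossings"
      using secant_crossing_on_line[OF assms p(3)] by blast
    then show ?thesis using unique_point[of l x p q] p l R_subset_L by blast
  qed
  then have "l \<inter> \<Union> R = l \<inter> crossings" using crossings_subset by blast
  then show ?thesis
    using card_Int_Diff[OF finite_line[OF l(1)], of "\<Union> R"] card_line[OF l(1)] assms
    by (simp add: secants_def)
qed

lemma tangency_point_or_secant_exists: "tangency_points \<noteq> {} \<or> secants \<noteq> {}"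
proof -
  have "\<not> L \<subseteq> R" using more_lines card_R card_mono[OF finite_R, of L] by auto
  then obtain l where l: "l \<in> L" "l \<notin> R" by blast
  from l(1) show ?thesis
    by (cases rule: line_cases) (use l(2) tangent_tangency_point in blast)+
qed

lemma crossing_on_line_if_tangency_points_on_line:
  assumes "a \<in> R" "tangency_points \<subseteq> a"
  shows "a \<inter> crossings \<noteq> {}"
  using tangency_point_or_secant_exists secant_crossing_on_line[OF _ assms(1)] assms(2)
    tangency_points_subset by blast

lemma crossings_exist: "crossings \<noteq> {}"
proof -
  obtain a where "a \<in> R" using card_R by fastforce
  then show ?thesis
    using crossing_on_line_if_tangency_points_on_line tangency_points_subset by blast
qed

lemma card_complement_lines_through:
  assumes "q \<in> crossings"
  shows "card (R - lines_through q) = 2"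
  using assms card_R lines_through_subset finite_lines_through
  by (simp add: crossings_def card_Diff_subset)

lemma oppositeI:
  assumes "p \<in> crossings" "q \<in> crossings" "lines_through p \<inter> lines_through q = {}"
  shows "opposite p q"
  unfolding opposite_def
  using assms card_complement_lines_through[of q] lines_through_subset[of p] finite_R
  by (intro card_subset_eq) (auto simp: crossings_def)

lemma crossings_off_line_cover:
  assumes "a \<in> R" "p \<in> crossings - a" "q \<in> crossings - a" "p \<noteq> q"
  shows "lines_through p \<union> lines_through q = R - {a}"
    and "lines_through p \<inter> lines_through q \<noteq> {}"
proof -
  let ?A = "lines_through p" and ?B = "lines_through q"
  have sub: "?A \<union> ?B \<subseteq> R - {a}" using assms by auto
  have card: "card ?A = 2" "card ?B = 2" "card (R - {a}) = 3"
    using assms card_R by (simp_all add: crossings_def)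
  have sum: "card ?A + card ?B = card (?A \<union> ?B) + card (?A \<inter> ?B)"
    using finite_lines_through by (intro card_Un_Int)
  have "card (?A \<union> ?B) \<le> 3" using card_mono[OF _ sub] card(3) finite_R by simp
  then show "?A \<inter> ?B \<noteq> {}" using sum card(1,2) by auto
  have "?A \<noteq> ?B" using assms inj_onD[OF inj_on_lines_through] by blast
  then have "\<not> ?A \<subseteq> ?B" using card(1,2) card_subset_eq[OF finite_lines_through] by metis
  then have "?A \<inter> ?B \<subset> ?A" by blast
  then have "card (?A \<inter> ?B) < 2"
    using psubset_card_mono[OF finite_lines_through, of _ p] card(1) by simp
  then have "3 \<le> card (?A \<union> ?B)" using sum card(1,2) by simp
  then show "?A \<union> ?B = R - {a}" using sub card(3) finite_R by (intro card_seteq) auto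
qed

lemma tangents_meet_on_line:
  assumes a: "a \<in> R" and e: "e \<in> tangents" "e \<inter> crossings = {p}" "p \<notin> a"
    and f: "f \<in> tangents" "f \<inter> crossings = {q}" "q \<notin> a" and "p \<noteq> q"
  obtains z where "z \<in> a" "z \<in> e" "z \<in> f"
proof -
  have pq: "p \<in> crossings - a" "q \<in> crossings - a" using e f by auto
  note cover = crossings_off_line_cover[OF a pq \<open>p \<noteq> q\<close>]
  obtain b where "b \<in> R" "p \<in> b" "q \<in> b" using cover(2) by auto
  then obtain x z where x: "x \<in> R" "p \<notin> x" "q \<notin> x" "z \<in> x" "z \<in> e" "z \<in> f"
    using tangents_meet[OF e(1,2) f(1,2) \<open>p \<noteq> q\<close>] by metis
  then have "x \<notin> R - {a}" unfolding cover(1)[symmetric] by simp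
  then show thesis using that x by blast
qed

lemma pencil_point:
  assumes a: "a \<in> R" and "2 \<le> card (tangency_points - a)"
  obtains u where "u \<in> a" "\<forall>l\<in>tangents. l \<inter> crossings \<inter> a = {} \<longrightarrow> u \<in> l"
proof -
  obtain p q where pq: "p \<in> tangency_points" "p \<notin> a" "q \<in> tangency_points" "q \<notin> a" "p \<noteq> q"
    using assms(2) card_le_Suc0_iff_eq[of "tangency_points - a"] finite_tangency_points by fastforce
  obtain e f where e: "e \<in> tangents" "e \<inter> crossings = {p}"
    and f: "f \<in> tangents" "f \<inter> crossings = {q}"
    using pq by (metis tangencyE)
  obtain u where u: "u \<in> a" "u \<in> e" "u \<in> f"
    using tangents_meet_on_line[OF a e pq(2) f pq(4,5)] .
  have "e \<in> L" "f \<in> L" "e \<noteq> a" "f \<noteq> a" using e f a by (auto simp: tangents_def)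
  then have unique: "z \<in> a \<Longrightarrow> z \<in> e \<or> z \<in> f \<Longrightarrow> z = u" for z
    using unique_point[of a e z u] unique_point[of a f z u] u a R_subset_L by blast
  have "u \<in> l" if l: "l \<in> tangents" "l \<inter> crossings \<inter> a = {}" for l
  proof -
    obtain s where s: "l \<inter> crossings = {s}" using l(1) by (rule tangent_tangency_point)
    then have "s \<notin> a" using l(2) by simp
    show ?thesis
    proof (cases "s = p")
      case True
      then show ?thesis
        using tangents_meet_on_line[OF a l(1) s \<open>s \<notin> a\<close> f pq(4)] pq(5) unique by metis
    next
      case False
      then show ?thesis
        using tangents_meet_on_line[OF a l(1) s \<open>s \<notin> a\<close> e pq(2)] unique by metis
    qed
  qed
  then show thesis using that u(1) by blast
qed

lemma card_crossings_le_6: "card crossings \<le> 6"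
  using card_crossings_le_choose card_R by (simp add: choose_two)

lemma card_crossings_le_if_pencil:
  assumes "a \<in> R" "2 \<le> card (tangency_points - a)"
  shows "card crossings \<le> r + 2"
proof -
  obtain u where u: "u \<in> a" "\<forall>l\<in>tangents. l \<inter> crossings \<inter> a = {} \<longrightarrow> u \<in> l"
    using assms by (rule pencil_point)
  have "tangency_points - a \<noteq> {}" using assms(2) by force
  then obtain p where p: "p \<in> tangency_points" "p \<notin> a" by blast
  obtain l where l: "l \<in> tangents" "l \<inter> crossings = {p}" using p(1) by (rule tangencyE)
  then have "u \<in> l" using u(2) p(2) by simp
  then have "u \<notin> crossings" using l(2) u(1) p(2) by auto
  have a_line: "a \<in> L" using assms(1) R_subset_L by blast
  have "card (insert u (crossings \<inter> a)) \<le> card a"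
    using u(1) finite_line[OF a_line] by (intro card_mono) auto
  then have "card (crossings \<inter> a) + 1 \<le> r"
    using \<open>u \<notin> crossings\<close> finite_crossings card_line[OF a_line] by simp
  moreover have "card (crossings - a) \<le> 3"
    using card_crossings_off_line_le[OF assms(1)] card_R by (simp add: choose_two)
  ultimately show ?thesis using card_Int_Diff[OF finite_crossings, of a] by linarith
qed

lemma point_on_tangents_off_line:
  assumes a: "a \<in> R"
  obtains u where "u \<in> P" "\<forall>l\<in>tangents. l \<inter> crossings \<inter> a = {} \<longrightarrow> u \<in> l"
proof (cases "2 \<le> card (tangency_points - a)")
  case True
  then show thesis using that pencil_point[OF a] Union_R_subset_P a by (metis UnionI subsetD)
next
  case False
  then have eq: "\<forall>p\<in>tangency_points - a. \<forall>q\<in>tangency_points - a. p = q"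
    using card_le_Suc0_iff_eq[of "tangency_points - a"] finite_tangency_points by simp
  obtain u where u: "u \<in> crossings" "tangency_points - a \<subseteq> {u}"
  proof (cases "tangency_points - a = {}")
    case True
    then show thesis using that crossings_exist by blast
  next
    case False
    then show thesis using that eq tangency_points_subset by blast
  qed
  have "u \<in> l" if l: "l \<in> tangents" "l \<inter> crossings \<inter> a = {}" for l
  proof -
    obtain p where p: "p \<in> tangency_points" "l \<inter> crossings = {p}"
      using l(1) by (rule tangent_tangency_point)
    then show ?thesis using u(2) l(2) by auto
  qed
  then show thesis using that[of u] u(1) crossings_subset_P by blast
qed

lemma transversal_number_le_4: "transversal_number P L \<le> 4"
proof -
  obtain a where a: "a \<in> R" "a \<inter> crossings \<noteq> {}"
    using crossings_exist crossings_subset by blast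
  obtain u where u: "u \<in> P" "\<forall>l\<in>tangents. l \<inter> crossings \<inter> a = {} \<longrightarrow> u \<in> l"
    using a(1) by (rule point_on_tangents_off_line)
  obtain T where T: "T \<subseteq> P" "card T < card R" "a \<inter> crossings \<subseteq> T" "\<forall>x\<in>R - {a}. T \<inter> x \<noteq> {}"
    using a(1) by (rule small_set_meeting_other_lines)
  show ?thesis
  proof (rule transversal_number_leI[of "insert u T"])
    show "insert u T \<subseteq> P" "card (insert u T) \<le> 4"
      using u(1) T(1,2) card_R finite_subset[OF T(1) finite_P] by (simp_all add: card_insert_if)
    show "insert u T \<inter> x \<noteq> {}" if "x \<in> R" for x using that a T(3,4) by blast
    show "insert u T \<inter> l \<noteq> {}"
      if "l \<in> tangents" "p \<in> tangency_points" "l \<inter> crossings = {p}" for l p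
      using u(2)[rule_format, OF that(1)] that(3) T(3) by (cases "p \<in> a") auto
    show "insert u T \<inter> l \<noteq> {}" if "l \<in> secants" for l
      using secant_crossing_on_line[OF that a(1)] T(3) by blast
  qed
qed

lemma transversal_number_le_3_if_tangency_points_on_line:
  assumes "a \<in> R" "tangency_points \<subseteq> a"
  shows "transversal_number P L \<le> 3"
proof -
  obtain T where T: "T \<subseteq> P" "card T < card R" "a \<inter> crossings \<subseteq> T" "\<forall>x\<in>R - {a}. T \<inter> x \<noteq> {}"
    using assms(1) by (rule small_set_meeting_other_lines)
  show ?thesis
  proof (rule transversal_number_leI[OF T(1)])
    show "card T \<le> 3" using T(2) card_R by simp
    show "T \<inter> x \<noteq> {}" if "x \<in> R" for x
      using that crossing_on_line_if_tangency_points_on_line[OF assms] T(3,4) by blast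
    show "T \<inter> l \<noteq> {}" if "p \<in> tangency_points" "l \<inter> crossings = {p}" for l p
      using that assms(2) T(3) by blast
    show "T \<inter> l \<noteq> {}" if "l \<in> secants" for l
      using secant_crossing_on_line[OF that assms(1)] T(3) by blast
  qed
qed

lemma card_points_lines_ge:
  "4 * r + 4 + card tangency_points + card secants + card (P - \<Union> R)
    \<le> card P + card L + card crossings"
  using card_points_eq card_lines_ge card_R by simp

lemma points_lines_ge_if_few_crossings:
  assumes "card crossings \<le> card tangency_points + card secants + card (P - \<Union> R)"
  shows "4 * r + 4 \<le> card P + card L"
  using assms card_points_lines_ge by linarith

lemma card_off_packing_ge:
  assumes "l \<in> secants"
  shows "r \<le> card (P - \<Union> R) + 2"
proof -
  have "card (l - \<Union> R) \<le> card (P - \<Union> R)"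
    using line_subset_P[OF secant_line[OF assms]] finite_P by (intro card_mono) auto
  then show ?thesis using card_secant_off_packing[OF assms] by simp
qed

lemma card_crossings_le_double: "card crossings \<le> 2 * r"
  using card_crossings_le card_R by simp

lemma line_avoiding_two_tangency_points:
  assumes "3 \<le> card tangency_points"
  obtains a where "a \<in> R" "2 \<le> card (tangency_points - a)"
proof -
  have False if few: "\<And>a. a \<in> R \<Longrightarrow> card (tangency_points - a) \<le> 1"
  proof -
    have "(\<Sum>a\<in>R. card tangency_points) \<le> (\<Sum>a\<in>R. card (tangency_points \<inter> a) + 1)"
    proof (rule sum_mono)
      fix a assume "a \<in> R"
      then show "card tangency_points \<le> card (tangency_points \<inter> a) + 1"
        using few[of a] card_Int_Diff[OF finite_tangency_points, of a] by linarith
    qed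
    also have "\<dots> = 2 * card tangency_points + card R"
      using sum_card_crossings_on_lines[OF tangency_points_subset]
      by (simp only: sum.distrib sum_constant) simp
    finally show False using assms card_R by simp
  qed
  then obtain a where "a \<in> R" "\<not> card (tangency_points - a) \<le> 1" by blast
  then show thesis using that[of a] by simp
qed

lemma points_lines_ge_if_secants:
  assumes "secants \<noteq> {}" "3 \<le> card tangency_points"
  shows "4 * r + 4 \<le> card P + card L"
proof -
  obtain l where l: "l \<in> secants" using assms(1) by blast
  then have "1 \<le> card secants" using finite_secants by (auto simp: Suc_le_eq card_gt_0_iff)
  moreover obtain a where "a \<in> R" "2 \<le> card (tangency_points - a)"
    using assms(2) by (rule line_avoiding_two_tangency_points)
  then have "card crossings \<le> r + 2" by (rule card_crossings_le_if_pencil)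
  ultimately show ?thesis
    using assms(2) card_off_packing_ge[OF l] by (intro points_lines_ge_if_few_crossings) linarith
qed

lemma opposite_tangency_points:
  assumes "card tangency_points \<le> 2" "\<And>a. a \<in> R \<Longrightarrow> \<not> tangency_points \<subseteq> a"
  obtains p q where "tangency_points = {p, q}" "p \<noteq> q" "opposite p q"
proof -
  obtain b where "b \<in> R" using card_R by fastforce
  then obtain p where p: "p \<in> tangency_points" using assms(2) by blast
  then have "p \<in> crossings" using tangency_points_subset by blast
  then obtain a where a: "a \<in> R" "p \<in> a" by (rule crossingE)
  then obtain q where q: "q \<in> tangency_points" "q \<notin> a" using assms(2) by blast
  have ne: "p \<noteq> q" using a(2) q(2) by blast
  then have eq: "tangency_points = {p, q}"
    using card_seteq[OF finite_tangency_points, of "{p, q}"] p q(1) assms(1) by simp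
  have "lines_through p \<inter> lines_through q = {}" using assms(2) eq by auto
  then have "opposite p q" using p q(1) tangency_points_subset by (blast intro: oppositeI)
  then show thesis by (rule that[OF eq ne])
qed

lemma points_lines_ge_if_disjoint_secants:
  assumes f: "f \<in> secants" and g: "g \<in> secants" and "f \<inter> g = {}" and "2 \<le> card tangency_points"
  shows "4 * r + 4 \<le> card P + card L"
proof (rule points_lines_ge_if_few_crossings)
  have lines: "f \<in> L" "g \<in> L" using f g by (simp_all add: secant_line)
  then have ne: "f \<noteq> g" using assms(3) line_nonempty by blast
  have "card {f, g} \<le> card secants" using f g finite_secants by (intro card_mono) auto
  then have two: "2 \<le> card secants" using ne by simp
  have "card (f - \<Union> R) + card (g - \<Union> R) = card ((f - \<Union> R) \<union> (g - \<Union> R))"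
    using assms(3) lines finite_line by (intro card_Un_disjoint[symmetric]) auto
  also have "\<dots> \<le> card (P - \<Union> R)"
    using lines line_subset_P finite_P by (intro card_mono) auto
  finally show "card crossings \<le> card tangency_points + card secants + card (P - \<Union> R)"
    using card_secant_off_packing[OF f] card_secant_off_packing[OF g] two assms(4)
      card_crossings_le_double by linarith
qed

lemma transversal_number_le_3_if_concurrent_secants:
  assumes "tangency_points = {p, q}" "opposite p q"
    and "w \<in> P" "\<And>l. l \<in> secants \<Longrightarrow> w \<in> l"
  shows "transversal_number P L \<le> 3"
proof (rule transversal_number_leI)
  show "{p, q, w} \<subseteq> P"
    using assms(1,3) tangency_points_subset crossings_subset_P by blast
  show "card {p, q, w} \<le> 3" by (simp add: card_insert_if)
  show "{p, q, w} \<inter> x \<noteq> {}" if "x \<in> R" for x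
    using opposite_cover[OF assms(2) that] by blast
  show "{p, q, w} \<inter> l \<noteq> {}" if "s \<in> tangency_points" "l \<inter> crossings = {s}" for l s
    using that assms(1) by blast
  show "{p, q, w} \<inter> l \<noteq> {}" if "l \<in> secants" for l using that assms(4) by blast
qed

lemma secants_cases:
  obtains (many) "3 \<le> card secants"
    | (disjoint) f g where "f \<in> secants" "g \<in> secants" "f \<inter> g = {}"
    | (concurrent) w where "w \<in> P" "\<And>l. l \<in> secants \<Longrightarrow> w \<in> l"
proof -
  consider (three) "3 \<le> card secants" | (none) "secants = {}" | (pair) f g where "secants = {f, g}"
    using finite_secants
    by (cases "card secants = 0"; cases "card secants = 1"; cases "card secants = 2")
      (auto simp: card_1_singleton_iff card_2_iff intro: insert_absorb)
  then show thesis
  proof cases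
    case three
    then show thesis by (rule many)
  next
    case none
    moreover obtain w where "w \<in> P" using crossings_exist crossings_subset_P by blast
    ultimately show thesis using concurrent by blast
  next
    case (pair f g)
    show thesis
    proof (cases "f \<inter> g = {}")
      case True
      then show thesis using disjoint[of f g] pair by simp
    next
      case False
      then obtain w where w: "w \<in> f" "w \<in> g" by blast
      then have "w \<in> P" using pair secant_line line_subset_P by blast
      then show thesis using concurrent[of w] pair w by auto
    qed
  qed
qed

lemma transversal_number_le_3_or_points_lines_ge_if_card_tangency_points_le_2:
  assumes "card tangency_points \<le> 2"
  shows "transversal_number P L \<le> 3 \<or> 4 * r + 4 \<le> card P + card L"
proof (cases "\<exists>a\<in>R. tangency_points \<subseteq> a")
  case True
  then show ?thesis using transversal_number_le_3_if_tangency_points_on_line by blast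
next
  case False
  then obtain p q where pq: "tangency_points = {p, q}" "p \<noteq> q" "opposite p q"
    using opposite_tangency_points[OF assms] by blast
  then have two: "card tangency_points = 2" by simp
  show ?thesis
  proof (cases rule: secants_cases)
    case many
    then obtain l where "l \<in> secants" by fastforce
    then have "card crossings \<le> card tangency_points + card secants + card (P - \<Union> R)"
      using card_off_packing_ge[of l] many two card_crossings_le_double card_crossings_le_6
      by linarith
    then show ?thesis using points_lines_ge_if_few_crossings by blast
  next
    case disjoint
    then show ?thesis using points_lines_ge_if_disjoint_secants two by simp
  next
    case concurrent
    then show ?thesis using transversal_number_le_3_if_concurrent_secants[OF pq(1,3)] by blast
  qed
qed

lemma transversal_number_le_3_if_pencil_and_cover:
  assumes "secants = {}" and d: "d \<in> R" "2 \<le> card (tangency_points - d)"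
    and xy: "{x, y} \<subseteq> crossings" "tangency_points \<inter> d \<subseteq> {x, y}"
      "R - {d} \<subseteq> lines_through x \<union> lines_through y"
  shows "transversal_number P L \<le> 3"
proof -
  obtain u where u: "u \<in> d" "\<forall>l\<in>tangents. l \<inter> crossings \<inter> d = {} \<longrightarrow> u \<in> l"
    using d by (rule pencil_point)
  show ?thesis
  proof (rule transversal_number_leI)
    show "{u, x, y} \<subseteq> P" using u(1) d(1) Union_R_subset_P xy(1) crossings_subset_P by blast
    show "card {u, x, y} \<le> 3" by (simp add: card_insert_if)
    show "{u, x, y} \<inter> z \<noteq> {}" if "z \<in> R" for z
    proof (cases "z = d")
      case False
      then have "z \<in> lines_through x \<union> lines_through y" using that xy(3) by blast
      then show ?thesis by auto
    qed (use u(1) in simp)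
    show "{u, x, y} \<inter> l \<noteq> {}"
      if "l \<in> tangents" "p \<in> tangency_points" "l \<inter> crossings = {p}" for l p
      using that u(2) xy(2) by (cases "p \<in> d") auto
    show "{u, x, y} \<inter> l \<noteq> {}" if "l \<in> secants" for l using that assms(1) by simp
  qed
qed

lemma noncollinear_crossing_cover:
  assumes d: "d \<in> R" and pq: "p \<in> crossings - d" "q \<in> crossings - d" "p \<noteq> q"
    and s: "s \<in> crossings" "\<And>a. a \<in> R \<Longrightarrow> p \<in> a \<Longrightarrow> q \<in> a \<Longrightarrow> s \<notin> a"
  obtains t where "t \<in> {p, q}" "R - {d} \<subseteq> lines_through s \<union> lines_through t"
proof -
  note cover = crossings_off_line_cover[OF d pq]
  obtain a where a: "a \<in> R" "p \<in> a" "q \<in> a" using cover(2) by auto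
  obtain b where b: "b \<in> R" "s \<in> b" "b \<noteq> d" using s(1) by (metis crossingE)
  have "a \<noteq> b" using s(2)[OF a] b(2) by blast
  have swap: "R - {d} \<subseteq> lines_through s \<union> lines_through t'"
    if "t \<in> a" "t \<in> b" "t' \<in> a" "R - {d} = lines_through t \<union> lines_through t'" for t t'
  proof -
    have "lines_through t = {a, b}" using a(1) b(1) \<open>a \<noteq> b\<close> that(1,2) by (rule lines_through_eq)
    then show ?thesis unfolding that(4) using a(1) b(1,2) that(3) by auto
  qed
  have "b \<in> lines_through p \<union> lines_through q" using b(1,3) unfolding cover(1) by simp
  then consider (through_p) "p \<in> b" | (through_q) "q \<in> b" by auto
  then show thesis
  proof cases
    case through_p
    then show thesis using swap[of p q] a cover(1) that[of q] by simp
  next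
    case through_q
    then show thesis using swap[of q p] a cover(1) that[of p] by (simp add: Un_commute)
  qed
qed

lemma transversal_number_le_3_if_card_tangency_points_eq_3:
  assumes "card tangency_points = 3" "secants = {}"
  shows "transversal_number P L \<le> 3"
proof (cases "\<exists>a\<in>R. tangency_points \<subseteq> a")
  case True
  then show ?thesis using transversal_number_le_3_if_tangency_points_on_line by blast
next
  case False
  obtain d where d: "d \<in> R" "2 \<le> card (tangency_points - d)"
    using line_avoiding_two_tangency_points assms(1) by (metis order_refl)
  obtain p q where pq: "p \<in> tangency_points" "p \<notin> d" "q \<in> tangency_points" "q \<notin> d" "p \<noteq> q"
    using d(2) card_le_Suc0_iff_eq[of "tangency_points - d"] finite_tangency_points by fastforce
  have crossing: "p \<in> crossings - d" "q \<in> crossings - d" using pq tangency_points_subset by auto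
  obtain a where a: "a \<in> R" "p \<in> a" "q \<in> a"
    using crossings_off_line_cover(2)[OF d(1) crossing pq(5)] by auto
  obtain s where s: "s \<in> tangency_points" "s \<notin> a" using False a(1) by blast
  have eq: "tangency_points = {p, q, s}"
    using s pq a assms(1)
    by (intro card_seteq[symmetric] finite_tangency_points) (auto simp: card_insert_if)
  have "s \<in> crossings" using s(1) tangency_points_subset by blast
  moreover have "s \<notin> x" if "x \<in> R" "p \<in> x" "q \<in> x" for x using False eq that by auto
  ultimately obtain t where t: "t \<in> {p, q}" "R - {d} \<subseteq> lines_through s \<union> lines_through t"
    using noncollinear_crossing_cover[OF d(1) crossing pq(5)] by blast
  have "{s, t} \<subseteq> crossings" using \<open>s \<in> crossings\<close> t(1) crossing by auto
  moreover have "tangency_points \<inter> d \<subseteq> {s, t}" using eq pq(2,4) by auto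
  ultimately show ?thesis
    using transversal_number_le_3_if_pencil_and_cover[OF assms(2) d] t(2) by blast
qed

lemma two_tangency_points_off_line_if_unopposed:
  assumes "4 \<le> card tangency_points" and q: "q \<in> crossings" and a: "a \<in> R" "q \<notin> a"
    and unopposed: "\<And>p. p \<in> tangency_points \<Longrightarrow> \<not> opposite p q"
  shows "2 \<le> card (tangency_points - a)"
proof -
  have "lines_through ` (tangency_points \<inter> a) \<subseteq> (\<lambda>y. {a, y}) ` lines_through q"
  proof
    fix X assume "X \<in> lines_through ` (tangency_points \<inter> a)"
    then obtain p where p: "p \<in> tangency_points" "p \<in> a" "X = lines_through p" by blast
    have crossing: "p \<in> crossings" using p(1) tangency_points_subset by blast
    then obtain y where y: "y \<in> R" "y \<noteq> a" "p \<in> y" "lines_through p = {a, y}"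
      using a(1) p(2) by (rule crossing_other_line)
    have "y \<in> lines_through q"
    proof (rule ccontr)
      assume "y \<notin> lines_through q"
      then have "lines_through p \<inter> lines_through q = {}" using y(4) a(2) by auto
      then show False using unopposed[OF p(1)] oppositeI[OF crossing q] by blast
    qed
    then show "X \<in> (\<lambda>y. {a, y}) ` lines_through q" using p(3) y(4) by blast
  qed
  then have "card (lines_through ` (tangency_points \<inter> a)) \<le> card (lines_through q)"
    using finite_lines_through by (rule surj_card_le[rotated])
  moreover have "inj_on lines_through (tangency_points \<inter> a)"
    using inj_on_subset[OF inj_on_lines_through] tangency_points_subset by blast
  ultimately have "card (tangency_points \<inter> a) \<le> 2"
    using q by (simp add: card_image crossings_def)
  then show ?thesis
    using assms(1) card_Int_Diff[OF finite_tangency_points, of a] by linarith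
qed

lemma transversal_number_le_3_if_two_pencils:
  assumes "secants = {}" and q: "q \<in> crossings" "R - lines_through q \<subseteq> {a, d}"
    and a: "a \<in> R" "2 \<le> card (tangency_points - a)"
    and d: "d \<in> R" "2 \<le> card (tangency_points - d)"
    and disjoint: "tangency_points \<inter> a \<inter> d = {}"
  shows "transversal_number P L \<le> 3"
proof -
  obtain u where u: "u \<in> a" "\<forall>l\<in>tangents. l \<inter> crossings \<inter> a = {} \<longrightarrow> u \<in> l"
    using a by (rule pencil_point)
  obtain v where v: "v \<in> d" "\<forall>l\<in>tangents. l \<inter> crossings \<inter> d = {} \<longrightarrow> v \<in> l"
    using d by (rule pencil_point)
  show ?thesis
  proof (rule transversal_number_leI)
    show "{q, u, v} \<subseteq> P"
      using q(1) crossings_subset_P a(1) d(1) u(1) v(1) Union_R_subset_P by blast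
    show "card {q, u, v} \<le> 3" by (simp add: card_insert_if)
    show "{q, u, v} \<inter> x \<noteq> {}" if "x \<in> R" for x
    proof (cases "x \<in> lines_through q")
      case False
      then show ?thesis using that q(2) u(1) v(1) by blast
    qed simp
    show "{q, u, v} \<inter> l \<noteq> {}"
      if l: "l \<in> tangents" "p \<in> tangency_points" "l \<inter> crossings = {p}" for l p
    proof -
      have "l \<inter> crossings \<inter> a = {} \<or> l \<inter> crossings \<inter> d = {}"
        unfolding l(3) using l(2) disjoint by blast
      then show ?thesis using u(2) v(2) l(1) by blast
    qed
    show "{q, u, v} \<inter> l \<noteq> {}" if "l \<in> secants" for l using that assms(1) by simp
  qed
qed

lemma transversal_number_le_3_if_unopposed_crossing:
  assumes "4 \<le> card tangency_points" "secants = {}" and q: "q \<in> crossings"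
    and unopposed: "\<And>p. p \<in> tangency_points \<Longrightarrow> \<not> opposite p q"
  shows "transversal_number P L \<le> 3"
proof -
  obtain a d where ad: "R - lines_through q = {a, d}" "a \<noteq> d"
    using card_complement_lines_through[OF q] by (auto simp: card_2_iff)
  then have off: "a \<in> R" "q \<notin> a" "d \<in> R" "q \<notin> d"
    using mem_lines_through[of _ q] by (metis DiffE insertCI)+
  note two_off = two_tangency_points_off_line_if_unopposed[OF assms(1) q _ _ unopposed]
  have "p \<notin> d" if p: "p \<in> tangency_points" "p \<in> a" for p
  proof
    assume "p \<in> d"
    then have "lines_through p = {a, d}" using off(1,3) ad(2) p(2) by (intro lines_through_eq)
    then show False using unopposed[OF p(1)] ad(1) by (simp add: opposite_def)
  qed
  then have "tangency_points \<inter> a \<inter> d = {}" by blast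
  then show ?thesis
    using off ad(1) two_off[OF off(1,2)] two_off[OF off(3,4)]
    by (intro transversal_number_le_3_if_two_pencils[OF assms(2) q]) simp_all
qed

lemma points_lines_ge_if_all_crossings_opposed:
  assumes "\<And>q. q \<in> crossings \<Longrightarrow> \<exists>p\<in>tangency_points. opposite p q"
  shows "4 * r + 4 \<le> card P + card L"
proof (rule points_lines_ge_if_few_crossings)
  have "lines_through ` crossings \<subseteq> (\<lambda>p. R - lines_through p) ` tangency_points"
  proof
    fix X assume "X \<in> lines_through ` crossings"
    then obtain q where q: "q \<in> crossings" "X = lines_through q" by blast
    then obtain p where "p \<in> tangency_points" "lines_through p = R - X"
      using assms by (auto simp: opposite_def)
    moreover from this have "X = R - lines_through p" using q(2) lines_through_subset by blast
    ultimately show "X \<in> (\<lambda>p. R - lines_through p) ` tangency_points" by blast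
  qed
  then have "card (lines_through ` crossings) \<le> card tangency_points"
    using finite_tangency_points by (rule surj_card_le[rotated])
  then show "card crossings \<le> card tangency_points + card secants + card (P - \<Union> R)"
    by (simp add: card_image[OF inj_on_lines_through])
qed

lemma transversal_number_le_3_or_points_lines_ge:
  "transversal_number P L \<le> 3 \<or> 4 * r + 4 \<le> card P + card L"
proof -
  consider (two) "card tangency_points \<le> 2"
    | (secant) "3 \<le> card tangency_points" "secants \<noteq> {}"
    | (three) "card tangency_points = 3" "secants = {}"
    | (four) "4 \<le> card tangency_points" "secants = {}"
    by linarith
  then show ?thesis
  proof cases
    case two
    then show ?thesis
      by (rule transversal_number_le_3_or_points_lines_ge_if_card_tangency_points_le_2)
  next
    case secant
    then show ?thesis using points_lines_ge_if_secants by blast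
  next
    case three
    then show ?thesis using transversal_number_le_3_if_card_tangency_points_eq_3 by blast
  next
    case four
    then show ?thesis
      using transversal_number_le_3_if_unopposed_crossing points_lines_ge_if_all_crossings_opposed
      by metis
  qed
qed

lemma opposite_crossing_exists:
  assumes "card crossings = 6" "p \<in> crossings"
  obtains q where "q \<in> crossings" "opposite q p"
proof -
  have "lines_through ` crossings = {X. X \<subseteq> R \<and> card X = 2}"
  proof (rule card_subset_eq)
    show "finite {X. X \<subseteq> R \<and> card X = 2}" using finite_R by simp
    show "lines_through ` crossings \<subseteq> {X. X \<subseteq> R \<and> card X = 2}"
      using lines_through_subset by (auto simp: crossings_def)
    show "card (lines_through ` crossings) = card {X. X \<subseteq> R \<and> card X = 2}"
      using n_subsets[OF finite_R, of 2] assms(1) card_R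
      by (simp add: card_image[OF inj_on_lines_through] choose_two)
  qed
  then have "R - lines_through p \<in> lines_through ` crossings"
    using card_complement_lines_through[OF assms(2)] by blast
  then show thesis using that by (auto simp: opposite_def)
qed

lemma transversal_number_le_2_if_one_tangency_point:
  assumes "tangency_points = {p}" "secants = {}" "card crossings = 6"
  shows "transversal_number P L \<le> 2"
proof -
  have p: "p \<in> crossings" using assms(1) tangency_points_subset by blast
  obtain q where q: "q \<in> crossings" "opposite q p"
    using assms(3) p by (rule opposite_crossing_exists)
  show ?thesis
  proof (rule transversal_number_leI)
    show "{p, q} \<subseteq> P" using p q(1) crossings_subset_P by blast
    show "card {p, q} \<le> 2" by (simp add: card_insert_if)
    show "{p, q} \<inter> x \<noteq> {}" if "x \<in> R" for x using opposite_cover[OF q(2) that] by blast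
    show "{p, q} \<inter> l \<noteq> {}" if "s \<in> tangency_points" "l \<inter> crossings = {s}" for l s
      using that assms(1) by blast
    show "{p, q} \<inter> l \<noteq> {}" if "l \<in> secants" for l using that assms(2) by simp
  qed
qed

lemma transversal_number_le_2_or_points_lines_ge:
  "transversal_number P L \<le> 2 \<or> 3 * r + 3 \<le> card P + card L"
proof (cases "3 * r + 3 \<le> card P + card L")
  case False
  then have "r + 1 + card tangency_points + card secants + card (P - \<Union> R) < card crossings"
    using card_points_lines_ge by linarith
  moreover have "1 \<le> card tangency_points + card secants"
    using tangency_point_or_secant_exists finite_tangency_points finite_secants
    by (auto simp: Suc_le_eq card_gt_0_iff)
  ultimately have "r = 3" and six: "card crossings = 6"
    and one: "card tangency_points + card secants = 1" and "card (P - \<Union> R) = 0"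
    using card_crossings_le_double card_crossings_le_6 by linarith+
  then have "secants = {}" using card_off_packing_ge by fastforce
  moreover from this one obtain p where "tangency_points = {p}" by (auto simp: card_1_singleton_iff)
  ultimately show ?thesis
    using transversal_number_le_2_if_one_tangency_point six by blast
qed simp

lemma transversal_number_mult_le: "transversal_number P L * (r + 1) \<le> card P + card L"
proof -
  have points_lines: "2 * r + 2 \<le> card P + card L"
    using card_points_eq card_crossings_le_double card_R more_lines by simp
  consider (four) "4 * r + 4 \<le> card P + card L"
    | (three) "transversal_number P L \<le> 3" "3 * r + 3 \<le> card P + card L"
    | (two) "transversal_number P L \<le> 2"
    using transversal_number_le_3_or_points_lines_ge transversal_number_le_2_or_points_lines_ge
    by blast
  then show ?thesis
  proof cases
    case four
    show ?thesis
      using four mult_le_mono1[OF transversal_number_le_4, of "r + 1"] by simp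
  next
    case three
    show ?thesis using mult_le_mono1[OF three(1), of "r + 1"] three(2) by simp
  next
    case two
    show ?thesis using mult_le_mono1[OF two, of "r + 1"] points_lines by simp
  qed
qed

end

theorem theorem2p11:
  fixes P :: "'a set" and L :: "'a set set" and r :: nat
  assumes "r \<ge> 2"
    and "linear_system P L"
    and "uniform_system r L"
    and "card L > two_packing_number P L"
    and "two_packing_number P L = 4"
  shows "real (transversal_number P L) \<le> (real (card P) + real (card L)) / (real r + 1)"
proof -
  obtain R where "two_packing P L R" "card R = two_packing_number P L"
    using linear_system_finite[OF assms(2)] by (rule two_packing_number_attained)
  then interpret maximum_four_packing P L R r
    using assms by unfold_locales simp_all
  have "real (transversal_number P L * (r + 1)) \<le> real (card P + card L)"
    using transversal_number_mult_le by (simp only: of_nat_le_iff)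
  then show ?thesis by (simp add: pos_le_divide_eq algebra_simps)
qed

end
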